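(* Let $k\geq 3$. (i) For every integer $r\geq 0$, $\lim_{n\to\infty}\big(h_{r,k}(n)\big)^{1/n}=1+2\cos\big(\frac{\pi}{k+1}\big)$. (ii) For every integer $r>0$, $\lim_{n\to\infty}\big(f_{r,k}(n)\big)^{1/n}=k-2$.
   Context: $[k]=\{1,\dots,k\}$ with its usual linear order. A word $\pi_1\cdots\pi_n$ is a staircase if $|\pi_{i+1}-\pi_i|\leq 1$ for all $i$. The staircase separation number $\mathcal{S}_k(\pi)$ of $\pi\in[k]^n$ is the number $d$ such that $\pi$ is a concatenation $\pi^{(1)}\cdots\pi^{(d+1)}$ of maximal staircase subwords (each $\pi^{(i)}$ is a staircase but $\pi^{(i)}$ followed by the first letter of $\pi^{(i+1)}$ is not); equivalently the number of indices $i$ with $|\pi_{i+1}-\pi_i|>1$. $h_{r,k}(n)=\#\{\pi\in[k]^n:\mathcal{S}_k(\pi)=r\}$. $\mathcal{J}_k(\pi)$ is defined by $i_1=1$, recursively $i_j=\inf\{m>i_{j-1}:|\pi_m-\pi_{i_{j-1}}|\leq1\}$ ($\inf\emptyset=+\infty$), and $\mathcal{J}_k(\pi)=\max\{r:i_r<\infty\}$; $f_{r,k}(n)=\#\{\pi\in[k]^n:\mathcal{J}_k(\pi)=r\}$. *)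

theory Defs
  imports "HOL-Analysis.Analysis" "HOL-Library.Extended_Nat"
begin

definition words :: "nat \<Rightarrow> nat \<Rightarrow> nat list set" where
  "words k n = {w. length w = n \<and> set w \<subseteq> {1..k}}"

definition near :: "nat \<Rightarrow> nat \<Rightarrow> bool" where
  "near a b \<longleftrightarrow> \<bar>int a - int b\<bar> \<le> 1"

definition staircase :: "nat list \<Rightarrow> bool" where
  "staircase w \<longleftrightarrow> (\<forall>i. Suc i < length w \<longrightarrow> near (w ! Suc i) (w ! i))"

definition staircase_decomp :: "nat list \<Rightarrow> nat list list \<Rightarrow> bool" where
  "staircase_decomp w ps \<longleftrightarrow>
     concat ps = w \<and> (\<forall>p\<in>set ps. p \<noteq> [] \<and> staircase p) \<and>
     (\<forall>i. Suc i < length ps \<longrightarrow> \<not> staircase (ps ! i @ [hd (ps ! Suc i)]))"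

text \<open>Every nonempty word has exactly one decomposition into maximal staircase subwords, so the
  description below determines the separation number, cf. \<open>staircase_sep_eq_card\<close>. It is
  unspecified for the empty word.\<close>

definition staircase_sep :: "nat list \<Rightarrow> nat" where
  "staircase_sep w = (THE d. \<exists>ps. staircase_decomp w ps \<and> length ps = d + 1)"

definition h :: "nat \<Rightarrow> nat \<Rightarrow> nat \<Rightarrow> nat" where
  "h r k n = card {w \<in> words k n. staircase_sep w = r}"

text \<open>Positions are counted from 1, so the \<open>m\<close>-th letter of \<open>w\<close> is \<open>w ! (m - 1)\<close>.
  On \<^typ>\<open>enat\<close>, the infimum of the empty set is \<open>\<infinity>\<close>; once the value \<open>\<infinity>\<close> is
  reached, all later sets are empty. The value at index 0 is a dummy.\<close>

fun jump_index :: "nat list \<Rightarrow> nat \<Rightarrow> enat" where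
  "jump_index w 0 = 0"
| "jump_index w (Suc 0) = 1"
| "jump_index w (Suc (Suc j)) =
     Inf {enat m | m. jump_index w (Suc j) < enat m \<and> m \<le> length w \<and>
            near (w ! (m - 1)) (w ! (the_enat (jump_index w (Suc j)) - 1))}"

definition jump_number :: "nat list \<Rightarrow> nat" where
  "jump_number w = Max {r. 1 \<le> r \<and> jump_index w r < \<infinity>}"

definition f :: "nat \<Rightarrow> nat \<Rightarrow> nat \<Rightarrow> nat" where
  "f r k n = card {w \<in> words k n. jump_number w = r}"


lemma near_sym: "near a b \<longleftrightarrow> near b a"
  by (auto simp: near_def)

lemma staircase_Nil [simp]: "staircase []"
  and staircase_single [simp]: "staircase [a]"
  by (auto simp: staircase_def)

lemma staircase_Cons2 [simp]:
  "staircase (a # b # w) \<longleftrightarrow> near b a \<and> staircase (b # w)"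
proof -
  have "(\<forall>i. P i) \<longleftrightarrow> P 0 \<and> (\<forall>i. P (Suc i))" for P :: "nat \<Rightarrow> bool"
    by (metis not0_implies_Suc)
  from this[of "\<lambda>i. Suc i < length (a # b # w) \<longrightarrow> near ((a # b # w) ! Suc i) ((a # b # w) ! i)"]
  show ?thesis unfolding staircase_def by simp
qed

lemma staircase_snoc:
  "p \<noteq> [] \<Longrightarrow> staircase (p @ [a]) \<longleftrightarrow> staircase p \<and> near a (last p)"
proof (induction p)
  case (Cons x p)
  then show ?case by (cases p) auto
qed simp

definition breaks :: "nat list \<Rightarrow> nat set" where
  "breaks w = {i. Suc i < length w \<and> \<not> near (w ! Suc i) (w ! i)}"

lemma finite_breaks [simp]: "finite (breaks w)"
  by (rule finite_subset[of _ "{..<length w}"]) (auto simp: breaks_def)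

lemma card_breaks_Cons2:
  "card (breaks (a # b # w)) = (if near b a then 0 else 1) + card (breaks (b # w))"
proof -
  have "breaks (a # b # w) = (if near b a then {} else {0}) \<union> Suc ` breaks (b # w)"
    (is "?L = ?R")
  proof (rule set_eqI)
    fix i show "i \<in> ?L \<longleftrightarrow> i \<in> ?R"
      by (cases i) (auto simp: breaks_def)
  qed
  then show ?thesis
    by (auto simp: card_image card_insert_if)
qed

lemma breaks_single [simp]: "breaks [] = {}" "breaks [a] = {}"
  by (auto simp: breaks_def)

lemma card_breaks_append:
  "staircase p \<Longrightarrow> p \<noteq> [] \<Longrightarrow> card (breaks (p @ b # w)) =
     (if near b (last p) then 0 else 1) + card (breaks (b # w))"
proof (induction p)
  case (Cons x p)
  then show ?case
    by (cases p) (auto simp: card_breaks_Cons2)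
qed simp

lemma staircase_breaks: "staircase p \<Longrightarrow> card (breaks p) = 0"
proof -
  assume "staircase p"
  then have "breaks p = {}" unfolding staircase_def breaks_def by blast
  then show ?thesis by simp
qed

lemma staircase_decomp_Cons2:
  "staircase_decomp w (p # q # ps) \<longleftrightarrow>
     p \<noteq> [] \<and> staircase p \<and> \<not> staircase (p @ [hd q]) \<and>
     (\<exists>w'. w = p @ w' \<and> staircase_decomp w' (q # ps))"
proof -
  have "(\<forall>i. Suc i < length (p # q # ps) \<longrightarrow>
           \<not> staircase ((p # q # ps) ! i @ [hd ((p # q # ps) ! Suc i)])) \<longleftrightarrow>
        \<not> staircase (p @ [hd q]) \<and>
        (\<forall>i. Suc i < length (q # ps) \<longrightarrow>
           \<not> staircase ((q # ps) ! i @ [hd ((q # ps) ! Suc i)]))" (is "?A \<longleftrightarrow> ?B \<and> ?C")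
  proof
    assume A: ?A
    have ?B using spec[OF A, of 0] by simp
    moreover have ?C
    proof
      fix i show "Suc i < length (q # ps) \<longrightarrow>
           \<not> staircase ((q # ps) ! i @ [hd ((q # ps) ! Suc i)])"
        using spec[OF A, of "Suc i"] by simp
    qed
    ultimately show "?B \<and> ?C" ..
  next
    assume BC: "?B \<and> ?C"
    show ?A
    proof
      fix i show "Suc i < length (p # q # ps) \<longrightarrow>
           \<not> staircase ((p # q # ps) ! i @ [hd ((p # q # ps) ! Suc i)])"
        using BC by (cases i) auto
    qed
  qed
  then show ?thesis
    unfolding staircase_decomp_def by auto
qed

lemma staircase_decomp_single:
  "staircase_decomp w [p] \<longleftrightarrow> p = w \<and> w \<noteq> [] \<and> staircase w"
  by (auto simp: staircase_decomp_def)

lemma staircase_decomp_length: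
  "staircase_decomp w ps \<Longrightarrow> w \<noteq> [] \<Longrightarrow> length ps = card (breaks w) + 1"
proof (induction ps arbitrary: w)
  case Nil
  then show ?case by (simp add: staircase_decomp_def)
next
  case (Cons p ps)
  show ?case
  proof (cases ps)
    case Nil
    with Cons.prems show ?thesis
      by (auto simp: staircase_decomp_single staircase_breaks)
  next
    case (Cons q qs)
    with Cons.prems obtain w' where w': "w = p @ w'" "staircase_decomp w' ps"
      "p \<noteq> []" "staircase p" "\<not> staircase (p @ [hd q])"
      by (auto simp: staircase_decomp_Cons2)
    from w'(2) Cons have ne: "w' \<noteq> []" "hd w' = hd q"
      by (auto simp: staircase_decomp_def hd_append)
    then obtain b v where bv: "w' = b # v" "b = hd q" by (cases w') auto
    have "\<not> near b (last p)" using w' bv staircase_snoc by auto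
    then have "card (breaks w) = 1 + card (breaks w')"
      using w' bv card_breaks_append[of p b v] by simp
    then show ?thesis using Cons.IH[OF w'(2) ne(1)] by simp
  qed
qed

lemma staircase_decomp_exists: "w \<noteq> [] \<Longrightarrow> \<exists>ps. staircase_decomp w ps"
proof (induction w)
  case (Cons a w)
  show ?case
  proof (cases w)
    case Nil
    then have "staircase_decomp (a # w) [[a]]" by (simp add: staircase_decomp_single)
    then show ?thesis ..
  next
    case w: (Cons b v)
    with Cons.IH obtain ps where ps: "staircase_decomp w ps" by auto
    with w obtain p qs where pq: "ps = p # qs"
      by (cases ps) (auto simp: staircase_decomp_def)
    from ps pq w obtain p' where p': "p = b # p'"
      by (cases p) (auto simp: staircase_decomp_def)
    show ?thesis
    proof (cases "near b a")
      case True
      have "staircase_decomp (a # w) ((a # p) # qs)"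
        using ps True pq p'
        by (cases qs) (auto simp: staircase_decomp_single staircase_decomp_Cons2)
      then show ?thesis ..
    next
      case False
      have "staircase_decomp (a # w) ([a] # ps)"
        using ps False pq p' by (auto simp: staircase_decomp_Cons2)
      then show ?thesis ..
    qed
  qed
qed simp

lemma staircase_sep_eq_card:
  assumes "w \<noteq> []"
  shows "staircase_sep w = card {i. Suc i < length w \<and> \<bar>int (w ! Suc i) - int (w ! i)\<bar> > 1}"
proof -
  obtain ps where "staircase_decomp w ps" using staircase_decomp_exists[OF assms] ..
  then have "staircase_sep w = card (breaks w)"
    unfolding staircase_sep_def
    by (intro the_equality) (use staircase_decomp_length[OF _ assms] in auto)
  then show ?thesis by (simp add: breaks_def near_def not_le)
qed

text \<open>The maximum in the definition of \<^const>\<open>jump_number\<close> is over a finite nonempty set.\<close>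

lemma Inf_enat_mem:
  fixes A :: "enat set" shows "A \<noteq> {} \<Longrightarrow> Inf A \<in> A"
  unfolding Inf_enat_def by (auto intro: LeastI)

lemma jump_index_bounds:
  "jump_index w (Suc j) < \<infinity> \<Longrightarrow>
     enat (Suc j) \<le> jump_index w (Suc j) \<and> jump_index w (Suc j) \<le> enat (max 1 (length w))"
proof (induction j)
  case 0
  then show ?case by (simp add: one_enat_def)
next
  case (Suc j)
  let ?S = "{enat m | m. jump_index w (Suc j) < enat m \<and> m \<le> length w \<and>
            near (w ! (m - 1)) (w ! (the_enat (jump_index w (Suc j)) - 1))}"
  have eq: "jump_index w (Suc (Suc j)) = Inf ?S" by simp
  have "?S \<noteq> {}"
  proof
    assume "?S = {}"
    then have "Inf ?S = \<infinity>" by (simp only: Inf_enat_def) simp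
    with Suc.prems show False unfolding eq by simp
  qed
  then have "Inf ?S \<in> ?S" by (rule Inf_enat_mem)
  then obtain m where m: "Inf ?S = enat m" "jump_index w (Suc j) < enat m" "m \<le> length w"
    unfolding mem_Collect_eq by (elim exE conjE)
  have "jump_index w (Suc j) < \<infinity>" using m(2) by (cases "jump_index w (Suc j)") auto
  with Suc.IH have "enat (Suc j) < enat m" using m(2) by (meson le_less_trans)
  then show ?case unfolding eq m(1) using m(3) by (simp add: Suc_le_eq)
qed

lemma finite_jump_set: "finite {r. 1 \<le> r \<and> jump_index w r < \<infinity>}"
proof (rule finite_subset)
  show "{r. 1 \<le> r \<and> jump_index w r < \<infinity>} \<subseteq> {..max 1 (length w)}"
  proof
    fix r assume r: "r \<in> {r. 1 \<le> r \<and> jump_index w r < \<infinity>}"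
    then obtain j where "r = Suc j" by (cases r) auto
    with r have "enat r \<le> jump_index w r \<and> jump_index w r \<le> enat (max 1 (length w))"
      using jump_index_bounds[of w j] by blast
    then have "enat r \<le> enat (max 1 (length w))"
      by (blast intro: order_trans)
    then show "r \<in> {..max 1 (length w)}" by simp
  qed
qed simp

lemma jump_set_nonempty: "1 \<in> {r. 1 \<le> r \<and> jump_index w r < \<infinity>}"
  by (simp add: one_enat_def)

end

theory Submission
  imports Defs
begin

text \<open>Both statistics are additive costs of a deterministic automaton with state set \<open>[k]\<close>. For
  \<open>S\<^sub>k\<close> the state is the last letter, and a letter costs 1 iff it is not near the state; for
  \<open>J\<^sub>k\<close> the state is the last letter selected by the recursion, and a letter costs 1 (and becomes
  the new state) iff it is near the state. The letters of cost 0 define a nonnegative transfer matrix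
  with Perron root \<open>\<mu>\<close>. A word of bounded cost uses boundedly many other letters, so a positive
  super-eigenvector bounds the number of words by a polynomial times \<open>\<mu>\<^sup>n\<close>, and a sub-eigenvector
  bounds it below by a constant times \<open>\<mu>\<^sup>n\<close>. For \<open>S\<^sub>k\<close> the matrix is the identity plus the
  adjacency matrix of a path, with eigenvector \<open>sin (j \<pi> / (k + 1))\<close>; for \<open>J\<^sub>k\<close> it is diagonal
  with largest entry \<open>k - 2\<close>, attained at the end letters.\<close>

section \<open>Growth of words of bounded cost\<close>

text \<open>The \<open>n\<close>-th roots of a positive constant and of \<open>real n ^ r\<close>
  tend to 1, so constant and polynomial factors do not affect the growth rate.\<close>

lemma root_tendsto_sandwich:
  fixes x :: "nat \<Rightarrow> real"
  assumes "c > 0" "C > 0" "\<mu> > 0"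
    and lower: "\<forall>\<^sub>F n in sequentially. c * \<mu> ^ n \<le> x n"
    and upper: "\<forall>\<^sub>F n in sequentially. x n \<le> C * real n ^ r * \<mu> ^ n"
  shows "(\<lambda>n. root n (x n)) \<longlonglongrightarrow> \<mu>"
proof (rule tendsto_sandwich)
  show "\<forall>\<^sub>F n in sequentially. root n c * \<mu> \<le> root n (x n)"
    using lower eventually_gt_at_top[of 0]
  proof eventually_elim
    case (elim n)
    then have "root n (c * \<mu> ^ n) \<le> root n (x n)" by simp
    with elim \<open>\<mu> > 0\<close> show ?case by (simp add: real_root_mult real_root_power_cancel)
  qed
  show "\<forall>\<^sub>F n in sequentially. root n (x n) \<le> root n C * root n (real n) ^ r * \<mu>"
    using upper eventually_gt_at_top[of 0]
  proof eventually_elim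
    case (elim n)
    then have "root n (x n) \<le> root n (C * real n ^ r * \<mu> ^ n)" by simp
    with elim \<open>\<mu> > 0\<close> show ?case
      by (simp add: real_root_mult real_root_power_cancel real_root_power)
  qed
  have "(\<lambda>n. root n c * \<mu>) \<longlonglongrightarrow> 1 * \<mu>"
    by (intro tendsto_intros LIMSEQ_root_const \<open>c > 0\<close>)
  then show "(\<lambda>n. root n c * \<mu>) \<longlonglongrightarrow> \<mu>" by simp
  have "(\<lambda>n. root n C * root n (real n) ^ r * \<mu>) \<longlonglongrightarrow> 1 * 1 ^ r * \<mu>"
    by (intro tendsto_intros LIMSEQ_root_const LIMSEQ_root \<open>C > 0\<close>)
  then show "(\<lambda>n. root n C * root n (real n) ^ r * \<mu>) \<longlonglongrightarrow> \<mu>" by simp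
qed

section \<open>Deterministic automata with additive costs\<close>

locale cost_automaton =
  fixes A :: "'a set" and S :: "'s set"
    and step :: "'s \<Rightarrow> 'a \<Rightarrow> 's" and costly :: "'s \<Rightarrow> 'a \<Rightarrow> bool"
  assumes finite_alphabet: "finite A" and finite_states: "finite S"
    and step_closed: "s \<in> S \<Longrightarrow> b \<in> A \<Longrightarrow> step s b \<in> S"
begin

fun cost :: "'s \<Rightarrow> 'a list \<Rightarrow> nat" where
  "cost s [] = 0"
| "cost s (b # w) = of_bool (costly s b) + cost (step s b) w"

definition words_of_cost :: "nat \<Rightarrow> nat \<Rightarrow> 's \<Rightarrow> 'a list set" where
  "words_of_cost r n s = {w. length w = n \<and> set w \<subseteq> A \<and> cost s w = r}"

abbreviation count :: "nat \<Rightarrow> nat \<Rightarrow> 's \<Rightarrow> real" where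
  "count r n s \<equiv> real (card (words_of_cost r n s))"

lemma finite_words_of_cost [simp]: "finite (words_of_cost r n s)"
  by (rule finite_subset[OF _ finite_lists_length_eq[OF finite_alphabet, of n]])
    (auto simp: words_of_cost_def)

lemma count_0: "count r 0 s = of_bool (r = 0)"
proof -
  have "words_of_cost r 0 s = (if r = 0 then {[]} else {})"
    by (auto simp: words_of_cost_def)
  then show ?thesis by simp
qed

text \<open>Split by the first letter: a free letter keeps the budget \<open>r\<close>, a costly one
  lowers it by one. The case \<open>r = 0\<close> stands apart because \<open>r - 1\<close>
  truncates to 0 and would admit words with a costly first letter.\<close>

lemma count_Suc:
  "count r (Suc n) s =
     (\<Sum>b | b \<in> A \<and> \<not> costly s b. count r n (step s b)) +
     (if r = 0 then 0 else \<Sum>b | b \<in> A \<and> costly s b. count (r - 1) n (step s b))"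
proof -
  define X where "X b = {w. b # w \<in> words_of_cost r (Suc n) s}" for b
  have X: "X b = (if b \<notin> A then {} else if \<not> costly s b then words_of_cost r n (step s b)
      else if r = 0 then {} else words_of_cost (r - 1) n (step s b))" for b
    by (auto simp: X_def words_of_cost_def)
  have "words_of_cost r (Suc n) s = (\<Union>b\<in>A. (#) b ` X b)"
    by (auto simp: X_def words_of_cost_def length_Suc_conv)
  also have "card \<dots> = (\<Sum>b\<in>A. card ((#) b ` X b))"
    using finite_alphabet by (intro card_UN_disjoint) (auto simp: X)
  also have "\<dots> = (\<Sum>b\<in>A. card (X b))"
    by (simp add: card_image)
  also have "\<dots> = (\<Sum>b | b \<in> A \<and> \<not> costly s b. card (X b)) + (\<Sum>b | b \<in> A \<and> costly s b. card (X b))"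
    using finite_alphabet
    by (subst sum.union_disjoint[symmetric]) (auto intro!: sum.cong)
  finally show ?thesis
    by (auto simp: X intro!: sum.cong)
qed

text \<open>Induction on \<open>r\<close>, then on \<open>n\<close>. Free letters multiply the bound
  by at most \<mu> because \<open>v\<close> is a super-eigenvector; each additional costly letter
  can be placed in at most linearly many positions, which raises the degree of the polynomial by
  one.\<close>

lemma count_upper:
  assumes "\<mu> > 0" and v_pos: "\<And>s. s \<in> S \<Longrightarrow> v s > 0"
    and super: "\<And>s. s \<in> S \<Longrightarrow> (\<Sum>b | b \<in> A \<and> \<not> costly s b. v (step s b)) \<le> \<mu> * v s"
  obtains C where "C > 0" "\<And>n s. s \<in> S \<Longrightarrow> count r n s \<le> C * real (Suc n) ^ r * \<mu> ^ n * v s"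
proof -
  have "\<exists>C>0. \<forall>n. \<forall>s\<in>S. count r n s \<le> C * real (Suc n) ^ r * \<mu> ^ n * v s"
  proof (induction r)
    case 0
    \<comment> \<open>Chosen so that \<open>C * v s\<close> is at least 1 for every state, which
      covers the empty word.\<close>
    define C where "C = 1 + (\<Sum>s\<in>S. 1 / v s)"
    have "C > 0" using v_pos unfolding C_def by (intro add_pos_nonneg sum_nonneg) (auto simp: less_imp_le)
    have C: "1 \<le> C * v s" if "s \<in> S" for s
    proof -
      have "1 / v s \<le> (\<Sum>s\<in>S. 1 / v s)"
        using that v_pos finite_states by (intro member_le_sum) (auto simp: less_imp_le)
      then show ?thesis using v_pos[OF that] by (simp add: C_def field_simps)
    qed
    have "count 0 n s \<le> C * \<mu> ^ n * v s" if "s \<in> S" for n s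
      using that
    proof (induction n arbitrary: s)
      case 0
      then show ?case using C by (simp add: count_0)
    next
      case (Suc n)
      have "count 0 (Suc n) s \<le> (\<Sum>b | b \<in> A \<and> \<not> costly s b. C * \<mu> ^ n * v (step s b))"
        using Suc step_closed by (auto simp: count_Suc intro!: sum_mono)
      also have "\<dots> = C * \<mu> ^ n * (\<Sum>b | b \<in> A \<and> \<not> costly s b. v (step s b))"
        by (simp add: sum_distrib_left)
      also have "\<dots> \<le> C * \<mu> ^ n * (\<mu> * v s)"
        using super[OF Suc.prems] \<open>C > 0\<close> \<open>\<mu> > 0\<close> by (intro mult_left_mono) auto
      finally show ?case by (simp add: mult_ac)
    qed
    with \<open>C > 0\<close> show ?case by (intro exI[of _ C]) auto
  next
    case (Suc r)
    then obtain C where C: "C > 0" 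
      "\<And>n s. s \<in> S \<Longrightarrow> count r n s \<le> C * real (Suc n) ^ r * \<mu> ^ n * v s"
      by blast
    \<comment> \<open>Large enough that one costly letter, followed by the bound for
      \<open>r\<close>, costs at most \<open>D * \<mu> * v s\<close>.\<close>
    define D where "D = 1 + (\<Sum>s\<in>S. (\<Sum>b | b \<in> A \<and> costly s b. C * v (step s b)) / (\<mu> * v s))"
    have nonneg: "0 \<le> (\<Sum>b | b \<in> A \<and> costly s b. C * v (step s b)) / (\<mu> * v s)" if "s \<in> S" for s
      using that v_pos step_closed \<open>C > 0\<close> \<open>\<mu> > 0\<close>
      by (intro divide_nonneg_nonneg sum_nonneg) (auto simp: less_imp_le)
    have "D > 0" using nonneg unfolding D_def by (intro add_pos_nonneg sum_nonneg) auto
    have D: "(\<Sum>b | b \<in> A \<and> costly s b. C * v (step s b)) \<le> D * \<mu> * v s" if "s \<in> S" for s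
    proof -
      have "(\<Sum>b | b \<in> A \<and> costly s b. C * v (step s b)) / (\<mu> * v s)
          \<le> (\<Sum>s\<in>S. (\<Sum>b | b \<in> A \<and> costly s b. C * v (step s b)) / (\<mu> * v s))"
        using that nonneg finite_states
        by (intro member_le_sum[of s S "\<lambda>s. (\<Sum>b | b \<in> A \<and> costly s b. C * v (step s b)) / (\<mu> * v s)"]) auto
      also have "\<dots> \<le> D" by (simp add: D_def)
      finally show ?thesis using v_pos[OF that] \<open>\<mu> > 0\<close> by (simp add: field_simps)
    qed
    have "count (Suc r) n s \<le> D * real (Suc n) ^ Suc r * \<mu> ^ n * v s" if "s \<in> S" for n s
      using that
    proof (induction n arbitrary: s)
      case 0
      then show ?case using \<open>D > 0\<close> v_pos[OF 0] by (simp add: count_0)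
    next
      case (Suc n)
      define N where "N = real (Suc n)"
      have "N > 0" by (simp add: N_def)
      have "(\<Sum>b | b \<in> A \<and> \<not> costly s b. count (Suc r) n (step s b))
          \<le> (\<Sum>b | b \<in> A \<and> \<not> costly s b. D * N ^ Suc r * \<mu> ^ n * v (step s b))"
        unfolding N_def using Suc step_closed by (intro sum_mono) blast
      also have "\<dots> = D * N ^ Suc r * \<mu> ^ n * (\<Sum>b | b \<in> A \<and> \<not> costly s b. v (step s b))"
        by (simp add: sum_distrib_left)
      also have "\<dots> \<le> D * N ^ Suc r * \<mu> ^ n * (\<mu> * v s)"
        using super[OF Suc.prems] \<open>D > 0\<close> \<open>\<mu> > 0\<close> \<open>N > 0\<close> by (intro mult_left_mono) auto
      finally have free: "(\<Sum>b | b \<in> A \<and> \<not> costly s b. count (Suc r) n (step s b))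
          \<le> D * N ^ Suc r * \<mu> ^ n * (\<mu> * v s)" .
      have "(\<Sum>b | b \<in> A \<and> costly s b. count r n (step s b))
          \<le> (\<Sum>b | b \<in> A \<and> costly s b. C * N ^ r * \<mu> ^ n * v (step s b))"
        unfolding N_def using Suc.prems step_closed C(2) by (intro sum_mono) blast
      also have "\<dots> = N ^ r * \<mu> ^ n * (\<Sum>b | b \<in> A \<and> costly s b. C * v (step s b))"
        by (simp add: sum_distrib_left mult_ac)
      also have "\<dots> \<le> N ^ r * \<mu> ^ n * (D * \<mu> * v s)"
        using D[OF Suc.prems] \<open>\<mu> > 0\<close> \<open>N > 0\<close> by (intro mult_left_mono) auto
      finally have "count (Suc r) (Suc n) s
          \<le> D * N ^ Suc r * \<mu> ^ n * (\<mu> * v s) + N ^ r * \<mu> ^ n * (D * \<mu> * v s)"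
        using free by (simp add: count_Suc)
      \<comment> \<open>Free first letters contribute \<open>N ^ Suc r\<close> and costly ones
        \<open>N ^ r\<close>; their sum is at most \<open>(N + 1) ^ Suc r\<close>.\<close>
      also have "\<dots> = (N ^ r * (N + 1)) * (D * \<mu> ^ Suc n * v s)"
        by (simp add: algebra_simps)
      also have "\<dots> \<le> ((N + 1) ^ r * (N + 1)) * (D * \<mu> ^ Suc n * v s)"
        using \<open>N > 0\<close> \<open>D > 0\<close> \<open>\<mu> > 0\<close> v_pos[OF Suc.prems]
        by (intro mult_right_mono power_mono) auto
      also have "N + 1 = real (Suc (Suc n))" by (simp add: N_def)
      finally show ?case by (simp only: power_Suc mult_ac)
    qed
    with \<open>D > 0\<close> show ?case by blast
  qed
  with that show ?thesis by blast
qed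

text \<open>Spend the \<open>r\<close> costly letters first, staying inside \<open>T\<close>, and
  then count free continuations from the state \<open>t\<close> reached, which does not depend on
  \<open>n\<close>. Keeping \<open>t\<close> in \<open>T\<close> matters because \<open>u\<close>
  may vanish elsewhere.\<close>

lemma count_lower:
  assumes "\<mu> > 0" and u_le: "\<And>s. s \<in> S \<Longrightarrow> u s \<le> 1"
    and sub: "\<And>s. s \<in> S \<Longrightarrow> \<mu> * u s \<le> (\<Sum>b | b \<in> A \<and> \<not> costly s b. u (step s b))"
    and "T \<subseteq> S" and T_step: "\<And>s. s \<in> T \<Longrightarrow> \<exists>b\<in>A. costly s b \<and> step s b \<in> T"
    and "s \<in> T"
  obtains t where "t \<in> T" "\<And>n. \<mu> ^ n * u t \<le> count r (n + r) s"
proof -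
  have "\<exists>t\<in>T. \<forall>n. \<mu> ^ n * u t \<le> count r (n + r) s"
    using \<open>s \<in> T\<close>
  proof (induction r arbitrary: s)
    case 0
    \<comment> \<open>Proved on all of \<open>S\<close>, since free letters may lead out of
      \<open>T\<close>.\<close>
    have "\<mu> ^ n * u s \<le> count 0 n s" if "s \<in> S" for n s
      using that
    proof (induction n arbitrary: s)
      case 0
      then show ?case using u_le by (simp add: count_0)
    next
      case (Suc n)
      have "\<mu> ^ Suc n * u s = \<mu> ^ n * (\<mu> * u s)" by simp
      also have "\<dots> \<le> \<mu> ^ n * (\<Sum>b | b \<in> A \<and> \<not> costly s b. u (step s b))"
        using sub[OF Suc.prems] \<open>\<mu> > 0\<close> by (intro mult_left_mono) auto
      also have "\<dots> = (\<Sum>b | b \<in> A \<and> \<not> costly s b. \<mu> ^ n * u (step s b))"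
        by (simp add: sum_distrib_left)
      also have "\<dots> \<le> count 0 (Suc n) s"
        using Suc step_closed by (auto simp: count_Suc intro!: sum_mono)
      finally show ?case .
    qed
    with 0 \<open>T \<subseteq> S\<close> show ?case by auto
  next
    case (Suc r)
    obtain b where b: "b \<in> A" "costly s b" "step s b \<in> T" using T_step[OF Suc.prems] by blast
    obtain t where t: "t \<in> T" "\<And>n. \<mu> ^ n * u t \<le> count r (n + r) (step s b)"
      using Suc.IH[OF b(3)] by blast
    have "count r m (step s b) \<le> count (Suc r) (Suc m) s" for m
    proof -
      have "count r m (step s b) \<le> (\<Sum>b | b \<in> A \<and> costly s b. count r m (step s b))"
        using b finite_alphabet by (intro member_le_sum[of b]) auto
      also have "\<dots> \<le> count (Suc r) (Suc m) s"
        by (auto simp: count_Suc intro!: sum_nonneg)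
      finally show ?thesis .
    qed
    with t show ?case by (metis add_Suc_right order_trans)
  qed
  with that show ?thesis by blast
qed

text \<open>Two vectors are used because the free-letter matrix may be reducible: \<open>v\<close>
  is positive everywhere, \<open>u\<close> only on \<open>T\<close>. The sum runs over words of
  length \<open>n\<close> whose first letter fixes the initial state, which leaves
  \<open>n - 1\<close> letters to read.\<close>

theorem root_count_tendsto:
  assumes "\<mu> > 0" and v_pos: "\<And>s. s \<in> S \<Longrightarrow> v s > 0"
    and super: "\<And>s. s \<in> S \<Longrightarrow> (\<Sum>b | b \<in> A \<and> \<not> costly s b. v (step s b)) \<le> \<mu> * v s"
    and u_le: "\<And>s. s \<in> S \<Longrightarrow> u s \<le> 1"
    and sub: "\<And>s. s \<in> S \<Longrightarrow> \<mu> * u s \<le> (\<Sum>b | b \<in> A \<and> \<not> costly s b. u (step s b))"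
    and "T \<subseteq> S" "T \<noteq> {}" and u_pos: "\<And>s. s \<in> T \<Longrightarrow> u s > 0"
    and T_step: "\<And>s. s \<in> T \<Longrightarrow> \<exists>b\<in>A. costly s b \<and> step s b \<in> T"
  shows "(\<lambda>n. root n (\<Sum>s\<in>S. count r (n - 1) s)) \<longlonglongrightarrow> \<mu>"
proof -
  obtain C where C: "C > 0" "\<And>n s. s \<in> S \<Longrightarrow> count r n s \<le> C * real (Suc n) ^ r * \<mu> ^ n * v s"
    using count_upper[OF assms(1-3)] by blast
  obtain s where "s \<in> T" using \<open>T \<noteq> {}\<close> by blast
  obtain t where t: "t \<in> T" "\<And>n. \<mu> ^ n * u t \<le> count r (n + r) s"
    using count_lower[OF \<open>\<mu> > 0\<close> u_le sub \<open>T \<subseteq> S\<close> T_step \<open>s \<in> T\<close>] by blast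
  show ?thesis
  proof (rule root_tendsto_sandwich)
    \<comment> \<open>The power \<open>Suc r\<close> pays for the \<open>r\<close> costly letters
      and the initial one.\<close>
    show "u t / \<mu> ^ Suc r > 0" using u_pos t \<open>\<mu> > 0\<close> by simp
    have "(\<Sum>s\<in>S. v s) > 0"
      using v_pos \<open>T \<subseteq> S\<close> \<open>T \<noteq> {}\<close> finite_states by (intro sum_pos) auto
    then show "C * (\<Sum>s\<in>S. v s) / \<mu> > 0" using \<open>\<mu> > 0\<close> C by simp
    show "\<forall>\<^sub>F n in sequentially. u t / \<mu> ^ Suc r * \<mu> ^ n \<le> (\<Sum>s\<in>S. count r (n - 1) s)"
      using eventually_ge_at_top[of "Suc r"]
    proof eventually_elim
      case (elim n)
      then obtain m where m: "n = m + Suc r" using le_Suc_ex by (metis add.commute)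
      have "u t / \<mu> ^ Suc r * \<mu> ^ n = \<mu> ^ m * u t"
        using \<open>\<mu> > 0\<close> by (simp add: m power_add)
      also have "\<dots> \<le> count r (n - 1) s" using t(2)[of m] by (simp add: m)
      also have "\<dots> \<le> (\<Sum>s\<in>S. count r (n - 1) s)"
        using \<open>s \<in> T\<close> \<open>T \<subseteq> S\<close> finite_states by (intro member_le_sum) auto
      finally show ?case .
    qed
    show "\<forall>\<^sub>F n in sequentially.
        (\<Sum>s\<in>S. count r (n - 1) s) \<le> C * (\<Sum>s\<in>S. v s) / \<mu> * real n ^ r * \<mu> ^ n"
      using eventually_gt_at_top[of 0]
    proof eventually_elim
      case (elim n)
      then obtain m where m: "n = Suc m" by (cases n) auto
      have "(\<Sum>s\<in>S. count r (n - 1) s) \<le> (\<Sum>s\<in>S. C * real n ^ r * \<mu> ^ m * v s)"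
        unfolding m diff_Suc_1 by (intro sum_mono C(2))
      also have "\<dots> = C * real n ^ r * \<mu> ^ m * (\<Sum>s\<in>S. v s)"
        by (simp only: sum_distrib_left)
      also have "\<dots> = C * (\<Sum>s\<in>S. v s) / \<mu> * real n ^ r * \<mu> ^ n"
        using \<open>\<mu> > 0\<close> by (simp add: m)
      finally show ?case .
    qed
  qed (fact \<open>\<mu> > 0\<close>)
qed

end

lemma card_words_Suc_decompose:
  "card {w \<in> words k (Suc n). P w} = (\<Sum>a\<in>{1..k}. card {w \<in> words k n. P (a # w)})"
proof -
  have fin: "finite {w \<in> words k m. Q w}" for m Q
    by (rule finite_subset[OF _ finite_lists_length_eq[of "{1..k}" m]]) (auto simp: words_def)
  have "{w \<in> words k (Suc n). P w} = (\<Union>a\<in>{1..k}. (#) a ` {w \<in> words k n. P (a # w)})"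
    by (auto simp: words_def length_Suc_conv)
  also have "card \<dots> = (\<Sum>a\<in>{1..k}. card ((#) a ` {w \<in> words k n. P (a # w)}))"
    using fin by (intro card_UN_disjoint) auto
  finally show ?thesis by (simp add: card_image)
qed

section \<open>The staircase separation number\<close>

lemma staircase_sep_breaks: "w \<noteq> [] \<Longrightarrow> staircase_sep w = card (breaks w)"
  by (simp add: staircase_sep_eq_card breaks_def near_def not_le)

interpretation sep: cost_automaton "{1..k}" "{1..k}" "\<lambda>_ b. b" "\<lambda>a b. \<not> near a b" for k
  by unfold_locales auto

lemma staircase_sep_Cons: "staircase_sep (a # w) = sep.cost a w"
proof (induction w arbitrary: a)
  case Nil
  then show ?case by (simp add: staircase_sep_breaks)
next
  case (Cons b w)
  then show ?case by (simp add: staircase_sep_breaks card_breaks_Cons2 near_sym)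
qed

lemma h_eq:
  assumes "n > 0"
  shows "real (h r k n) = (\<Sum>a\<in>{1..k}. sep.count k r (n - 1) a)"
proof -
  obtain m where m: "n = Suc m" using assms by (cases n) auto
  have "{w \<in> words k m. staircase_sep (a # w) = r} = sep.words_of_cost k r m a" for a
    unfolding words_def sep.words_of_cost_def staircase_sep_Cons by auto
  then show ?thesis
    by (simp only: m h_def card_words_Suc_decompose diff_Suc_1 of_nat_sum)
qed

text \<open>The path is extended by the vertices \<open>0\<close> and \<open>k + 1\<close>, where the sine vanishes.\<close>

lemma sum_near_sin:
  assumes "a \<in> {1..k}"
  defines "\<theta> \<equiv> pi / (real k + 1)"
  shows "(\<Sum>b | b \<in> {1..k} \<and> near a b. sin (real b * \<theta>)) = (1 + 2 * cos \<theta>) * sin (real a * \<theta>)"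
proof -
  have "real (k + 1) * \<theta> = pi" by (simp add: \<theta>_def add_ac)
  then have "sin (real (k + 1) * \<theta>) = 0" by simp
  then have zero: "sin (real b * \<theta>) = 0" if "b = 0 \<or> b = k + 1" for b
    using that by auto
  have "(\<Sum>b | b \<in> {1..k} \<and> near a b. sin (real b * \<theta>)) = (\<Sum>b\<in>{a - 1, a, a + 1}. sin (real b * \<theta>))"
  proof (rule sum.mono_neutral_left)
    show "{b \<in> {1..k}. near a b} \<subseteq> {a - 1, a, a + 1}" by (auto simp: near_def)
    have "b = 0 \<or> b = k + 1" if "b \<in> {a - 1, a, a + 1} - {b \<in> {1..k}. near a b}" for b
      using that assms by (auto simp: near_def)
    then show "\<forall>b\<in>{a - 1, a, a + 1} - {b \<in> {1..k}. near a b}. sin (real b * \<theta>) = 0"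
      using zero by blast
  qed simp
  also have "\<dots> = sin (real a * \<theta> - \<theta>) + sin (real a * \<theta>) + sin (real a * \<theta> + \<theta>)"
  proof -
    \<comment> \<open>Since \<open>a\<close> is positive, \<open>a - 1\<close> is not
      truncated.\<close>
    obtain c where "a = Suc c" using assms(1) by (cases a) auto
    then show ?thesis by (simp add: algebra_simps)
  qed
  also have "\<dots> = (1 + 2 * cos \<theta>) * sin (real a * \<theta>)"
    by (simp add: sin_add sin_diff algebra_simps)
  finally show ?thesis .
qed

text \<open>The sine vector is a positive exact eigenvector, so it serves as both \<open>v\<close>
  and \<open>u\<close>. The letters 1 and 3 are not near each other, so alternating between them
  makes every step costly.\<close>

lemma root_h_tendsto:
  assumes "k \<ge> 3"
  shows "(\<lambda>n. root n (real (h r k n))) \<longlonglongrightarrow> 1 + 2 * cos (pi / (real k + 1))"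
proof -
  define \<theta> where "\<theta> = pi / (real k + 1)"
  have "cos \<theta> \<ge> 0"
    using assms by (intro cos_ge_zero) (auto simp: \<theta>_def field_simps)
  have sin_pos: "sin (real a * \<theta>) > 0" if "a \<in> {1..k}" for a
  proof (rule sin_gt_zero)
    have "real a * pi < (real k + 1) * pi" using that by (intro mult_strict_right_mono) auto
    then show "real a * \<theta> < pi" by (simp add: \<theta>_def field_simps)
  qed (use that in \<open>simp add: \<theta>_def\<close>)
  have eigen: "(\<Sum>b | b \<in> {1..k} \<and> \<not> \<not> near a b. sin (real b * \<theta>)) = (1 + 2 * cos \<theta>) * sin (real a * \<theta>)"
    if "a \<in> {1..k}" for a
    using sum_near_sin[OF that] by (simp add: \<theta>_def)
  have "(\<lambda>n. root n (\<Sum>a\<in>{1..k}. sep.count k r (n - 1) a)) \<longlonglongrightarrow> 1 + 2 * cos \<theta>"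
  proof (rule sep.root_count_tendsto[where v = "\<lambda>a. sin (real a * \<theta>)" and u = "\<lambda>a. sin (real a * \<theta>)"
        and T = "{1, 3}"])
    show "\<exists>b\<in>{1..k}. \<not> near a b \<and> b \<in> {1, 3}" if "a \<in> {1, 3}" for a
    \<comment> \<open>The map \<open>4 - a\<close> swaps 1 and 3.\<close>
    proof (rule bexI[of _ "4 - a"])
      show "\<not> near a (4 - a) \<and> 4 - a \<in> {1, 3}" using that by (auto simp: near_def)
      show "4 - a \<in> {1..k}" using that assms by auto
    qed
  qed (use \<open>cos \<theta> \<ge> 0\<close> sin_pos sin_pos[of 1] sin_pos[of 3] eigen assms in auto)
  \<comment> \<open>The case \<open>n = 0\<close> is excluded: the empty word has no first letter,
    and its separation number is unspecified.\<close>
  moreover have "\<forall>\<^sub>F n in sequentially.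
      root n (\<Sum>a\<in>{1..k}. sep.count k r (n - 1) a) = root n (real (h r k n))"
    using eventually_gt_at_top[of 0] by eventually_elim (simp only: h_eq)
  ultimately show ?thesis
    unfolding \<theta>_def by (rule Lim_transform_eventually)
qed

section \<open>The jump number\<close>

interpretation jump: cost_automaton "{1..k}" "{1..k}" "\<lambda>a b. if near a b then b else a" near for k
  by unfold_locales auto

lemma jump_index_infinity_mono:
  assumes "jump_index w (Suc i) = \<infinity>" "i \<le> j"
  shows "jump_index w (Suc j) = \<infinity>"
  using assms(2)
proof (induction j rule: dec_induct)
  case base
  show ?case by (fact assms)
next
  case (step j)
  then show ?case by (simp add: Inf_enat_def)
qed

text \<open>Once an index is infinite, all later ones are, so the maximum sits just before the first
  infinite index.\<close>

lemma jump_number_eqI: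
  assumes "jump_index w (Suc r) < \<infinity>" "jump_index w (Suc (Suc r)) = \<infinity>"
  shows "jump_number w = Suc r"
  unfolding jump_number_def
proof (rule Max_eqI[OF finite_jump_set])
  show "Suc r \<in> {r. 1 \<le> r \<and> jump_index w r < \<infinity>}" using assms by simp
  fix q assume q: "q \<in> {r. 1 \<le> r \<and> jump_index w r < \<infinity>}"
  then obtain j where j: "q = Suc j" by (cases q) auto
  have "\<not> Suc r \<le> j"
    using jump_index_infinity_mono[OF assms(2), of j] q j by auto
  then show "q \<le> Suc r" using j by simp
qed

text \<open>The invariant after reading the first \<open>q\<close> letters: the last selected position is \<open>p\<close>, and no
  later letter read so far is near the \<open>p\<close>-th one.\<close>

lemma jump_number_cost_drop:
  assumes "jump_index w (Suc j) = enat p" "1 \<le> p" "p \<le> q" "q \<le> length w"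
    and "\<And>m. p < m \<Longrightarrow> m \<le> q \<Longrightarrow> \<not> near (w ! (m - 1)) (w ! (p - 1))"
  shows "jump_number w = Suc j + jump.cost (w ! (p - 1)) (drop q w)"
  using assms
proof (induction "length w - q" arbitrary: j p q)
  case 0
  then have "q = length w" by simp
  \<comment> \<open>With the whole word read, the invariant leaves no candidate for the next
    index.\<close>
  have "{enat m | m. jump_index w (Suc j) < enat m \<and> m \<le> length w \<and>
            near (w ! (m - 1)) (w ! (the_enat (jump_index w (Suc j)) - 1))} = {}"
    using 0 \<open>q = length w\<close> by auto
  then have "jump_index w (Suc (Suc j)) = \<infinity>"
    by (simp only: jump_index.simps) (simp add: Inf_enat_def)
  then show ?case using 0 \<open>q = length w\<close> by (simp add: jump_number_eqI)
next
  case (Suc d)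
  then have "q < length w" by simp
  then have drop: "drop q w = w ! q # drop (Suc q) w" by (simp add: Cons_nth_drop_Suc)
  show ?case
  proof (cases "near (w ! (p - 1)) (w ! q)")
    case True
    have "jump_index w (Suc (Suc j)) = Inf {enat m | m. p < m \<and> m \<le> length w \<and>
        near (w ! (m - 1)) (w ! (p - 1))}"
      using Suc.prems(1) by simp
    \<comment> \<open>The letter \<open>w ! q\<close> has position \<open>Suc q\<close> counted from
      1. It is a candidate, and the invariant excludes all positions from \<open>p + 1\<close> to
      \<open>q\<close>.\<close>
    also have "\<dots> = enat (Suc q)"
    proof (rule antisym)
      show "Inf {enat m | m. p < m \<and> m \<le> length w \<and> near (w ! (m - 1)) (w ! (p - 1))} \<le> enat (Suc q)"
        using True \<open>q < length w\<close> Suc.prems(3) by (intro Inf_lower) (auto simp: near_sym)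
      show "enat (Suc q) \<le> Inf {enat m | m. p < m \<and> m \<le> length w \<and> near (w ! (m - 1)) (w ! (p - 1))}"
        using Suc.prems(5) by (intro Inf_greatest) (force simp: not_less_eq_eq[symmetric])
    qed
    finally have "jump_number w = Suc (Suc j) + jump.cost (w ! (Suc q - 1)) (drop (Suc q) w)"
      using Suc.hyps(2) \<open>q < length w\<close> by (intro Suc.hyps(1)) auto
    then show ?thesis using True by (simp add: drop)
  next
    case False
    have "jump_number w = Suc j + jump.cost (w ! (p - 1)) (drop (Suc q) w)"
    proof (rule Suc.hyps(1))
      show "\<not> near (w ! (m - 1)) (w ! (p - 1))" if "p < m" "m \<le> Suc q" for m
        using that Suc.prems(5)[of m] False by (auto simp: le_Suc_eq near_sym)
    qed (use Suc.hyps(2) Suc.prems \<open>q < length w\<close> in auto)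
    then show ?thesis using False by (simp add: drop)
  qed
qed

text \<open>The first letter is always selected but only sets the initial state of the automaton,
  whence the extra 1. The invariant holds vacuously at \<open>p = q = 1\<close>.\<close>

lemma jump_number_Cons: "jump_number (a # w) = Suc (jump.cost a w)"
  using jump_number_cost_drop[of "a # w" 0 1 1] by (simp add: one_enat_def)

lemma f_eq:
  assumes "n > 0"
  shows "real (f (Suc r) k n) = (\<Sum>a\<in>{1..k}. jump.count k r (n - 1) a)"
proof -
  obtain m where m: "n = Suc m" using assms by (cases n) auto
  have "{w \<in> words k m. jump_number (a # w) = (Suc r)} = jump.words_of_cost k r m a" for a
    unfolding words_def jump.words_of_cost_def jump_number_Cons by auto
  then show ?thesis
    by (simp only: m f_def card_words_Suc_decompose diff_Suc_1 of_nat_sum)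
qed

section \<open>Free letters of the jump automaton and the rate \<open>k - 2\<close>\<close>

lemma card_not_near_le:
  assumes "k \<ge> 3" "a \<in> {1..k}"
  shows "card {b \<in> {1..k}. \<not> near a b} \<le> k - 2"
proof -
  \<comment> \<open>A neighbour of \<open>a\<close> inside the alphabet; together with
    \<open>a\<close> itself it gives two near letters.\<close>
  define c where "c = (if a = 1 then 2 else a - 1)"
  have "card {b \<in> {1..k}. \<not> near a b} \<le> card ({1..k} - {a, c})"
    using assms by (intro card_mono) (auto simp: near_def c_def)
  also have "\<dots> = k - 2"
    using assms by (subst card_Diff_subset) (auto simp: c_def)
  finally show ?thesis .
qed

lemma card_not_near_1: "card {b \<in> {1..k}. \<not> near 1 b} = k - 2"
proof -
  have "{b \<in> {1..k}. \<not> near 1 b} = {3..k}" by (auto simp: near_def)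
  then show ?thesis by simp
qed

text \<open>The constant vector is a super-eigenvector because no state has more than
  \<open>k - 2\<close> free letters. The indicator of the end letter 1 is an eigenvector for
  \<open>k - 2\<close>, and reading 1 in state 1 is a costly step that stays in
  \<open>T\<close>.\<close>

lemma root_f_tendsto:
  assumes "k \<ge> 3"
  shows "(\<lambda>n. root n (real (f (Suc r) k n))) \<longlonglongrightarrow> real k - 2"
proof -
  \<comment> \<open>Free letters do not change the state, so the matrix is diagonal.\<close>
  have sum: "(\<Sum>b | b \<in> {1..k} \<and> \<not> near a b. g (if near a b then b else a)) =
      real (card {b \<in> {1..k}. \<not> near a b}) * g a" for g :: "nat \<Rightarrow> real" and a
    by simp
  have "(\<lambda>n. root n (\<Sum>a\<in>{1..k}. jump.count k r (n - 1) a)) \<longlonglongrightarrow> real k - 2"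
  proof (rule jump.root_count_tendsto[where v = "\<lambda>_. 1" and u = "\<lambda>a. of_bool (a = 1)" and T = "{1}"],
      goal_cases)
    case (3 a)
    then show ?case
      unfolding sum using card_not_near_le[OF assms, of a] assms by simp
  next
    case (5 a)
    then show ?case
      unfolding sum using card_not_near_1[of k] assms by (cases "a = 1") (auto simp: of_nat_diff)
  qed (use assms in \<open>auto simp: near_def intro!: bexI[of _ 1]\<close>)
  moreover have "\<forall>\<^sub>F n in sequentially.
      root n (\<Sum>a\<in>{1..k}. jump.count k r (n - 1) a) = root n (real (f (Suc r) k n))"
    using eventually_gt_at_top[of 0] by eventually_elim (simp only: f_eq)
  ultimately show ?thesis by (rule Lim_transform_eventually)
qed

theorem theorem1p5:
  fixes k :: nat
  assumes "k \<ge> 3"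
  shows "(\<forall>r::nat. (\<lambda>n. root n (real (h r k n))) \<longlonglongrightarrow> 1 + 2 * cos (pi / (real k + 1))) \<and>
         (\<forall>r::nat. r > 0 \<longrightarrow> (\<lambda>n. root n (real (f r k n))) \<longlonglongrightarrow> real k - 2)"
  using root_h_tendsto[OF assms] root_f_tendsto[OF assms] by (metis gr0_implies_Suc)

end
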